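(* Let $\Omega\subseteq\mathbb{Z}^n$ be finite. Then the facet gap $\varphi$ of $\Omega$ satisfies $$\frac1\varphi\le\sqrt{n}\cdot\operatorname{ufc}(\operatorname{conv}\Omega).$$
   Context: The facet gap $\varphi>0$ of a finite set $\Omega\subseteq\mathbb{R}^n$ is the smallest Euclidean distance $d(\omega,\operatorname{aff}\mathcal F)$ over all facets $\mathcal F$ of $\operatorname{conv}\Omega$ and all $\omega\in\Omega\setminus \mathcal F$ ($\operatorname{aff}$ = affine hull; facets are faces of codimension one relative to $\operatorname{aff}\Omega$); $\Omega$ is assumed to contain at least two points so that $\varphi$ is well-defined. For an integral polytope $P\subseteq\mathbb{R}^n$, the unary facet complexity $\operatorname{ufc}(P)$ is the smallest integer $M\ge0$ such that $P$ can be described as the intersection of $\operatorname{aff}P$ with half-spaces $\{p:\langle p,a\rangle\le b\}$, where $a\in\mathbb{Z}^n$, $b\in\mathbb{R}$ and $\|a\|_\infty\le M$. *)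

theory Defs
  imports "HOL-Analysis.Analysis"
begin

text \<open>The lattice of integer vectors. (The library set \<open>\<int>\<close> at type \<open>real ^ 'n\<close> would only contain
  the integer multiples of the all-ones vector.)\<close>

definition integer_vectors :: "(real ^ 'n) set" where
  "integer_vectors = {v. \<forall>i. v $ i \<in> \<int>}"

text \<open>\<open>facet_of\<close> demands a nonempty face of dimension \<open>aff_dim (convex hull \<Omega>) - 1\<close>,
  where \<open>aff_dim (convex hull \<Omega>) = aff_dim \<Omega>\<close>.
  The minimum is meaningful only for finite \<open>\<Omega>\<close> with at least two points.\<close>

definition facet_gap :: "(real ^ 'n) set \<Rightarrow> real" where
  "facet_gap \<Omega> =
     Min {infdist \<omega> (affine hull F) | \<omega> F. F facet_of (convex hull \<Omega>) \<and> \<omega> \<in> \<Omega> - F}"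

text \<open>\<open>P\<close> is cut out of its affine hull by half-spaces \<open>{p. p \<bullet> a \<le> b}\<close> with
  integral normals of sup-norm at most \<open>M\<close>; \<open>H\<close> is the (possibly empty) set of pairs \<open>(a, b)\<close>.\<close>

definition facet_describable :: "(real ^ 'n) set \<Rightarrow> nat \<Rightarrow> bool" where
  "facet_describable P M \<longleftrightarrow>
     (\<exists>H :: ((real ^ 'n) \<times> real) set.
        (\<forall>(a, b) \<in> H. a \<in> integer_vectors \<and> infnorm a \<le> real M) \<and>
        P = affine hull P \<inter> (\<Inter>(a, b) \<in> H. {p. p \<bullet> a \<le> b}))"

text \<open>Unary facet complexity; meaningful for integral polytopes, for which a suitable \<open>M\<close> exists.\<close>

definition ufc :: "(real ^ 'n) set \<Rightarrow> nat" where
  "ufc P = (LEAST M. facet_describable P M)"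

end

theory Submission
  imports Defs
begin

text \<open>
  Let \<open>P = conv \<Omega>\<close> be described with normals of sup-norm at most \<open>M = ufc P\<close>. Only finitely many
  normals \<open>a\<close> occur, and each right-hand side may be lowered to \<open>max {\<langle>\<omega>, a\<rangle> | \<omega> \<in> \<Omega>}\<close>, an integer.
  Every facet \<open>F\<close> is then cut out by some \<open>\<langle>p, a\<rangle> = b\<close> of the description, so a point \<open>\<omega> \<in> \<Omega> - F\<close>
  satisfies \<open>\<langle>\<omega>, a\<rangle> \<le> b - 1\<close>, and Cauchy-Schwarz bounds its distance to \<open>aff F\<close> from below by
  \<open>1 / \<parallel>a\<parallel>\<^sub>2 \<ge> 1 / (sqrt n * M)\<close>. That some description with integral normals exists at all follows
  from Gram-Schmidt orthogonalisation over the rationals.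
\<close>

section \<open>Rational vectors and orthogonal projection\<close>

definition rational_vectors :: "(real ^ 'n) set" where
  "rational_vectors = {v. \<forall>i. v $ i \<in> \<rat>}"

lemma integer_vectors_subset_rational: "integer_vectors \<subseteq> rational_vectors"
  using Ints_subset_Rats by (auto simp: integer_vectors_def rational_vectors_def)

lemma rational_vectors_add:
  "u \<in> rational_vectors \<Longrightarrow> v \<in> rational_vectors \<Longrightarrow> u + v \<in> rational_vectors"
  by (simp add: rational_vectors_def)

lemma rational_vectors_diff:
  "u \<in> rational_vectors \<Longrightarrow> v \<in> rational_vectors \<Longrightarrow> u - v \<in> rational_vectors"
  by (simp add: rational_vectors_def)

lemma rational_vectors_scaleR:
  "c \<in> \<rat> \<Longrightarrow> v \<in> rational_vectors \<Longrightarrow> c *\<^sub>R v \<in> rational_vectors"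
  by (simp add: rational_vectors_def)

lemma inner_rational_vectors:
  "u \<in> rational_vectors \<Longrightarrow> v \<in> rational_vectors \<Longrightarrow> u \<bullet> v \<in> \<rat>"
  by (auto simp: rational_vectors_def inner_vec_def intro!: Rats_sum)

lemma inner_integer_vectors:
  "u \<in> integer_vectors \<Longrightarrow> v \<in> integer_vectors \<Longrightarrow> u \<bullet> v \<in> \<int>"
  by (auto simp: integer_vectors_def inner_vec_def intro!: Ints_sum)

text \<open>Each new vector costs one Gram-Schmidt step. Without normalisation this uses field
  operations only, so no square root leads out of the rationals.\<close>

lemma rational_orthogonal_projection:
  assumes "finite S" "S \<subseteq> rational_vectors" "u \<in> rational_vectors"
  shows "\<exists>w \<in> span S. w \<in> rational_vectors \<and> (\<forall>s\<in>S. (u - w) \<bullet> s = 0)"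
  using assms
proof (induction S arbitrary: u rule: finite_induct)
  case empty
  then show ?case by (auto simp: rational_vectors_def)
next
  case (insert s S)
  obtain p where p: "p \<in> span S" "p \<in> rational_vectors" "\<And>x. x \<in> S \<Longrightarrow> (s - p) \<bullet> x = 0"
    using insert.IH[of s] insert.prems by auto
  obtain q where q: "q \<in> span S" "q \<in> rational_vectors" "\<And>x. x \<in> S \<Longrightarrow> (u - q) \<bullet> x = 0"
    using insert.IH[of u] insert.prems by auto
  \<comment> \<open>If \<open>s\<close> lies in \<open>span S\<close>, then \<open>s = p\<close> and
    the quotient is 0 by the convention on division; \<open>w = q\<close> is then still the
    projection.\<close>
  define l where "l = ((u - q) \<bullet> (s - p)) / ((s - p) \<bullet> (s - p))"
  define w where "w = q + l *\<^sub>R (s - p)"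
  have "l \<in> \<rat>"
    unfolding l_def using insert.prems p q
    by (intro Rats_divide inner_rational_vectors rational_vectors_diff) auto
  then have "w \<in> rational_vectors"
    unfolding w_def using insert.prems p q
    by (intro rational_vectors_add rational_vectors_scaleR rational_vectors_diff) auto
  moreover have "w \<in> span (insert s S)"
  proof -
    have "p \<in> span (insert s S)" "q \<in> span (insert s S)"
      using p(1) q(1) span_mono[OF subset_insertI] by blast+
    then show ?thesis
      unfolding w_def by (intro span_add span_scale span_diff) (auto intro: span_base)
  qed
  moreover have ortho: "(u - w) \<bullet> x = 0" if "x \<in> S" for x
    using p(3)[OF that] q(3)[OF that] by (simp add: w_def algebra_simps)
  moreover have "(u - w) \<bullet> s = 0"
  proof -
    \<comment> \<open>Since \<open>p\<close> lies in \<open>span S\<close>, orthogonality to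
      \<open>s\<close> reduces to orthogonality to \<open>s - p\<close>, which the choice of
      \<open>l\<close> enforces.\<close>
    have "orthogonal (u - w) p"
      using ortho by (intro orthogonal_to_span[OF p(1)]) (simp add: orthogonal_def)
    moreover have "(u - w) \<bullet> (s - p) = (u - q) \<bullet> (s - p) - l * ((s - p) \<bullet> (s - p))"
      by (simp add: w_def algebra_simps)
    moreover have "\<dots> = 0"
      by (simp add: l_def)
    ultimately show ?thesis
      by (simp add: orthogonal_def inner_diff_right)
  qed
  ultimately show ?case by auto
qed

lemma clear_denominators:
  fixes v :: "real ^ 'n"
  assumes "v \<in> rational_vectors"
  obtains k :: nat where "k > 0" "real k *\<^sub>R v \<in> integer_vectors"
proof -
  have "\<exists>d::nat. d > 0 \<and> real d * v $ i \<in> \<int>" for i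
  proof -
    obtain a b :: int where "b > 0" "v $ i = of_int a / of_int b"
      using assms unfolding rational_vectors_def by (metis Rats_cases' mem_Collect_eq)
    then have "real (nat b) * v $ i = of_int a" by simp
    with \<open>b > 0\<close> show ?thesis by (intro exI[of _ "nat b"]) simp
  qed
  then obtain d :: "'n \<Rightarrow> nat" where d: "\<And>i. d i > 0" "\<And>i. real (d i) * v $ i \<in> \<int>"
    by metis
  define k where "k = (\<Prod>i\<in>UNIV. d i)"
  have "real k * v $ i \<in> \<int>" for i
  proof -
    have "real k * v $ i = real (\<Prod>j\<in>UNIV - {i}. d j) * (real (d i) * v $ i)"
      unfolding k_def by (subst prod.remove[of UNIV i]) auto
    then show ?thesis
      using d(2)[of i] by (metis Ints_mult Ints_of_nat)
  qed
  moreover have "k > 0" using d(1) by (simp add: k_def)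
  ultimately show ?thesis using that by (simp add: integer_vectors_def)
qed

text \<open>A description may consist of infinitely many pairs \<open>(a, b)\<close>; this leaves
  only finitely many distinct normals among them.\<close>

lemma finite_bounded_integer_vectors:
  "finite {a :: real ^ 'n. a \<in> integer_vectors \<and> infnorm a \<le> real M}" (is "finite ?A")
proof (rule finite_subset)
  let ?Z = "real_of_int ` {- int M..int M}"
  show "?A \<subseteq> vec_lambda ` (PiE UNIV (\<lambda>_. ?Z))"
  proof
    fix a assume a: "a \<in> ?A"
    have "a $ i \<in> ?Z" for i
    proof -
      obtain z where z: "a $ i = of_int z"
        using a by (auto simp: integer_vectors_def elim: Ints_cases)
      have "\<bar>a $ i\<bar> \<le> real M"
        using component_le_infnorm_cart[of a i] a by auto
      with z show ?thesis by (intro image_eqI[of _ _ z]) auto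
    qed
    then show "a \<in> vec_lambda ` (PiE UNIV (\<lambda>_. ?Z))"
      by (intro image_eqI[of _ _ "vec_nth a"]) auto
  qed
  show "finite (vec_lambda ` (PiE UNIV (\<lambda>_. ?Z)) :: (real ^ 'n) set)"
    by (intro finite_imageI finite_PiE) auto
qed

section \<open>Integral descriptions of integral polytopes\<close>

text \<open>Otherwise the convex set \<open>F\<close> would contain the whole hull, whereas a facet
  is a proper face.\<close>

lemma facet_of_convex_hull_exterior_vertex:
  assumes "F facet_of (convex hull S)"
  obtains w where "w \<in> S - F"
proof -
  have "\<not> S \<subseteq> F"
  proof
    assume "S \<subseteq> F"
    moreover have "convex F"
      using assms by (meson convex_convex_hull face_of_imp_convex facet_of_imp_face_of)
    ultimately have "convex hull S \<subseteq> F" by (rule hull_minimal)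
    then have "F = convex hull S"
      using facet_of_imp_subset[OF assms] by blast
    with assms show False by simp
  qed
  then show ?thesis using that by blast
qed

text \<open>Replaces a real normal \<open>c\<close> by an integral one: the component of
  \<open>u - v\<close> orthogonal to the directions of the facet is rational, and a multiple of it
  is integral. The two half-spaces need agree only on the affine hull.\<close>

lemma integral_facet_normal:
  fixes \<Omega> :: "(real ^ 'n) set"
  assumes fin: "finite \<Omega>" and int: "\<Omega> \<subseteq> integer_vectors"
    and le: "convex hull \<Omega> \<subseteq> {x. c \<bullet> x \<le> d}"
    and facet: "(convex hull \<Omega> \<inter> {x. c \<bullet> x = d}) facet_of (convex hull \<Omega>)"
  obtains a b where "a \<in> integer_vectors"
    "\<And>x. x \<in> affine hull \<Omega> \<Longrightarrow> x \<bullet> a \<le> b \<longleftrightarrow> c \<bullet> x \<le> d"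
proof -
  let ?P = "convex hull \<Omega>"
  define C where "C = ?P \<inter> {x. c \<bullet> x = d}"
  have C: "C facet_of ?P" using facet by (simp add: C_def)
  obtain W where W: "W \<subseteq> \<Omega>" "C = convex hull W"
    using face_of_convex_hull_subset[OF finite_imp_compact[OF fin] facet_of_imp_face_of[OF C]]
    by metis
  have "W \<noteq> {}" using W C by (auto simp: facet_of_def)
  then obtain v where v: "v \<in> W" by auto
  obtain u where u: "u \<in> \<Omega> - C"
    using facet_of_convex_hull_exterior_vertex[OF C] .
  have uP: "u \<in> ?P" using u by (auto intro: hull_inc)
  have WC: "W \<subseteq> C" using W by (simp add: hull_subset)
  have cu: "c \<bullet> u < d"
    using le u uP by (auto simp: C_def order_le_less)
  have affC: "affine hull C \<subseteq> {x. c \<bullet> x = d}"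
    by (intro hull_minimal affine_hyperplane) (auto simp: C_def)
  \<comment> \<open>\<open>span S\<close> is the direction space of the affine hull of the
    facet.\<close>
  define S where "S = (\<lambda>x. x - v) ` W"
  have rat: "x - v \<in> rational_vectors" if "x \<in> \<Omega>" for x
    using int that v W(1) integer_vectors_subset_rational
    by (intro rational_vectors_diff) auto
  have "finite S" "S \<subseteq> rational_vectors"
    using rat W(1) fin by (auto simp: S_def intro: finite_subset)
  then obtain w where w: "w \<in> span S" "w \<in> rational_vectors"
      and orth: "\<And>s. s \<in> S \<Longrightarrow> (u - v - w) \<bullet> s = 0"
    using rational_orthogonal_projection[of S "u - v"] rat u by blast
  define r where "r = u - v - w"
  have orthw: "r \<bullet> w = 0"
    using orthogonal_to_span[OF w(1), of r] orth by (auto simp: orthogonal_def r_def)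
  have cspan: "c \<bullet> x = 0" if "x \<in> span S" for x
  proof -
    have "c \<bullet> y = d" if "y \<in> W" for y
      using that WC by (auto simp: C_def)
    then have "c \<bullet> s = 0" if "s \<in> S" for s
      using that v by (auto simp: S_def inner_diff_right)
    then show ?thesis
      using orthogonal_to_span[OF that, of c] by (auto simp: orthogonal_def)
  qed
  \<comment> \<open>\<open>c\<close> vanishes on \<open>w\<close>, so the value is
    \<open>c \<bullet> u - d\<close>.\<close>
  have "c \<bullet> r < 0"
    using cspan[OF w(1)] cu v WC by (auto simp: r_def C_def inner_diff_right)
  then have "r \<noteq> 0" by auto
  have "r \<in> rational_vectors"
    unfolding r_def using rat u w(2) by (intro rational_vectors_diff[of "u - v"]) auto
  then obtain k where k: "k > 0" "real k *\<^sub>R r \<in> integer_vectors"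
    by (rule clear_denominators)
  \<comment> \<open>The sign puts \<open>u\<close> on the same side of the new hyperplane as of the
    old one.\<close>
  define a where "a = - (real k *\<^sub>R r)"
  define b where "b = a \<bullet> v"
  have "a \<in> integer_vectors" using k by (auto simp: a_def integer_vectors_def)
  have aW: "a \<bullet> x = b" if "x \<in> W" for x
    using orth[of "x - v"] that by (simp add: a_def b_def S_def r_def inner_diff_right)
  have "a \<bullet> u - b = - (real k * (r \<bullet> r))"
    using orthw by (simp add: a_def b_def r_def inner_diff_right algebra_simps)
  then have au: "a \<bullet> u < b"
    using k \<open>r \<noteq> 0\<close> by (smt (verit) inner_gt_zero_iff mult_pos_pos of_nat_0_less_iff)
  have "C \<subseteq> {x. a \<bullet> x = b}"
    unfolding W(2) by (intro hull_minimal) (auto simp: aW convex_hyperplane)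
  \<comment> \<open>These slacks at \<open>u\<close> are the weights for which
    \<open>\<beta> *\<^sub>R c - \<alpha> *\<^sub>R a\<close> takes the same value at
    \<open>u\<close> as on \<open>C\<close>.\<close>
  define \<alpha> where "\<alpha> = d - c \<bullet> u"
  define \<beta> where "\<beta> = b - a \<bullet> u"
  have "\<alpha> > 0" "\<beta> > 0" using cu au by (auto simp: \<alpha>_def \<beta>_def)
  have "u \<notin> affine hull C" using affC cu by auto
  then have "aff_dim (insert u C) = aff_dim ?P"
    using C by (simp add: aff_dim_insert facet_of_def)
  then have hull: "affine hull (insert u C) = affine hull \<Omega>"
    using aff_dim_eq_full_gen[of "insert u C" ?P] uP by (auto simp: C_def)
  \<comment> \<open>Both affine functionals vanish on \<open>C\<close>, and \<open>C\<close> and \<open>u\<close> span \<open>aff \<Omega>\<close>; hence they are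
     proportional there.\<close>
  have "affine hull (insert u C) \<subseteq> {x. (\<beta> *\<^sub>R c - \<alpha> *\<^sub>R a) \<bullet> x = \<beta> * d - \<alpha> * b}"
  proof (intro hull_minimal affine_hyperplane)
    show "insert u C \<subseteq> {x. (\<beta> *\<^sub>R c - \<alpha> *\<^sub>R a) \<bullet> x = \<beta> * d - \<alpha> * b}"
      using \<open>C \<subseteq> {x. a \<bullet> x = b}\<close>
      by (auto simp: \<alpha>_def \<beta>_def C_def inner_diff_left algebra_simps)
  qed
  then have proportional: "\<beta> * (c \<bullet> x - d) = \<alpha> * (a \<bullet> x - b)" if "x \<in> affine hull \<Omega>" for x
    using that hull by (auto simp: inner_diff_left algebra_simps)
  have "x \<bullet> a \<le> b \<longleftrightarrow> c \<bullet> x \<le> d" if "x \<in> affine hull \<Omega>" for x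
  proof -
    have "a \<bullet> x \<le> b \<longleftrightarrow> \<alpha> * (a \<bullet> x - b) \<le> 0"
      using \<open>\<alpha> > 0\<close> by (simp add: mult_le_0_iff)
    also have "\<dots> \<longleftrightarrow> c \<bullet> x \<le> d"
      using \<open>\<beta> > 0\<close> by (simp add: mult_le_0_iff flip: proportional[OF that])
    finally show ?thesis by (simp add: inner_commute)
  qed
  with \<open>a \<in> integer_vectors\<close> show ?thesis using that by blast
qed

text \<open>Ensures that the \<open>LEAST\<close> in \<open>ufc\<close> is attained. In an
  irredundant description every half-space cuts out a facet, so its normal can be made
  integral.\<close>

lemma facet_describable_integral_polytope:
  fixes \<Omega> :: "(real ^ 'n) set"
  assumes fin: "finite \<Omega>" and int: "\<Omega> \<subseteq> integer_vectors"
  shows "\<exists>M. facet_describable (convex hull \<Omega>) M"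
proof -
  let ?P = "convex hull \<Omega>"
  have "polyhedron ?P" using fin by (simp add: polyhedron_convex_hull)
  then obtain \<H> where "finite \<H>" and seq: "?P = affine hull ?P \<inter> \<Inter>\<H>"
      and faces: "\<And>h. h \<in> \<H> \<Longrightarrow> \<exists>a b. a \<noteq> 0 \<and> h = {x. a \<bullet> x \<le> b}"
      and min: "\<And>\<H>'. \<H>' \<subset> \<H> \<Longrightarrow> ?P \<subset> affine hull ?P \<inter> \<Inter>\<H>'"
    by (simp only: polyhedron_Int_affine_minimal) meson
  then obtain c d where cd: "\<And>h. h \<in> \<H> \<Longrightarrow> c h \<noteq> 0 \<and> h = {x. c h \<bullet> x \<le> d h}"
    by metis
  have "\<exists>a b. a \<in> integer_vectors \<and> (\<forall>x \<in> affine hull \<Omega>. x \<bullet> a \<le> b \<longleftrightarrow> x \<in> h)"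
    if h: "h \<in> \<H>" for h
  proof -
    have "?P \<subseteq> {x. c h \<bullet> x \<le> d h}" using seq h cd[OF h] by blast
    moreover have "(?P \<inter> {x. c h \<bullet> x = d h}) facet_of ?P"
      using facet_of_polyhedron_explicit[OF \<open>finite \<H>\<close> seq cd min] h by blast
    ultimately obtain a b where "a \<in> integer_vectors"
        "\<And>x. x \<in> affine hull \<Omega> \<Longrightarrow> x \<bullet> a \<le> b \<longleftrightarrow> c h \<bullet> x \<le> d h"
      using integral_facet_normal[OF fin int] by blast
    with cd[OF h] show ?thesis by blast
  qed
  then obtain a b where a: "\<And>h. h \<in> \<H> \<Longrightarrow> a h \<in> integer_vectors"
      and ab: "\<And>h x. h \<in> \<H> \<Longrightarrow> x \<in> affine hull \<Omega> \<Longrightarrow> x \<bullet> a h \<le> b h \<longleftrightarrow> x \<in> h"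
    by metis
  \<comment> \<open>The sum bounds every summand and, unlike a maximum, also makes sense for empty
    \<open>\<H>\<close>.\<close>
  define M where "M = nat \<lceil>\<Sum>h\<in>\<H>. infnorm (a h)\<rceil>"
  define H where "H = (\<lambda>h. (a h, b h)) ` \<H>"
  have M: "infnorm (a h) \<le> real M" if "h \<in> \<H>" for h
  proof -
    have "infnorm (a h) \<le> (\<Sum>h\<in>\<H>. infnorm (a h))"
      using \<open>finite \<H>\<close> that by (intro member_le_sum) (auto simp: infnorm_pos_le)
    then show ?thesis unfolding M_def by linarith
  qed
  have "affine hull ?P \<inter> \<Inter>\<H> = affine hull ?P \<inter> (\<Inter>(a, b)\<in>H. {p. p \<bullet> a \<le> b})"
    using ab by (auto simp: H_def)
  with seq have PH: "?P = affine hull ?P \<inter> (\<Inter>(a, b)\<in>H. {p. p \<bullet> a \<le> b})"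
    by (rule trans)
  have "\<forall>(a, b)\<in>H. a \<in> integer_vectors \<and> infnorm a \<le> real M"
    using a M by (auto simp: H_def)
  then have "facet_describable ?P M"
    unfolding facet_describable_def using PH by (intro exI[of _ H] conjI)
  then show ?thesis ..
qed

section \<open>The facet gap\<close>

text \<open>A subfamily of least cardinality that still describes \<open>P\<close> is irredundant,
  and the facets of \<open>P\<close> are exactly those cut out by its members.\<close>

lemma facet_normal_of_description:
  fixes P :: "'a :: euclidean_space set"
  assumes "finite \<H>"
    and seq: "P = affine hull P \<inter> \<Inter>\<H>"
    and eq: "\<And>h. h \<in> \<H> \<Longrightarrow> a h \<noteq> 0 \<and> h = {x. a h \<bullet> x \<le> b h}"
    and C: "C facet_of P"
  obtains h where "h \<in> \<H>" "C = P \<inter> {x. a h \<bullet> x = b h}"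
proof -
  define Q where "Q = (\<lambda>\<G>. \<G> \<subseteq> \<H> \<and> P = affine hull P \<inter> \<Inter>\<G>)"
  have "Q \<H>" using seq by (simp add: Q_def)
  then obtain \<G> where \<G>: "Q \<G>" and min: "\<And>\<G>'. Q \<G>' \<Longrightarrow> card \<G> \<le> card \<G>'"
    using arg_min_natI[of Q \<H> card] arg_min_nat_le[of Q _ card] by metis
  have sub: "\<G> \<subseteq> \<H>" and eq\<G>: "P = affine hull P \<inter> \<Inter>\<G>"
    using \<G> unfolding Q_def by blast+
  have fin: "finite \<G>" using sub \<open>finite \<H>\<close> by (rule finite_subset)
  have psub: "P \<subset> affine hull P \<inter> \<Inter>\<G>'" if "\<G>' \<subset> \<G>" for \<G>'
  proof -
    have "\<not> Q \<G>'" using min[of \<G>'] psubset_card_mono[OF fin that] by auto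
    then show ?thesis
      using that sub eq\<G> unfolding Q_def by blast
  qed
  have "a h \<noteq> 0 \<and> h = {x. a h \<bullet> x \<le> b h}" if "h \<in> \<G>" for h
    using eq sub that by blast
  from facet_of_polyhedron_explicit[OF fin eq\<G> this psub] C sub show ?thesis
    using that by blast
qed

text \<open>With right-hand side \<open>B a\<close> a half-space depends on its normal alone, so
  finitely many suffice; \<open>B a\<close> is an integer because it is attained at a lattice
  point.\<close>

lemma integral_facet_inequality:
  fixes \<Omega> :: "(real ^ 'n) set"
  assumes fin: "finite \<Omega>" and int: "\<Omega> \<subseteq> integer_vectors"
    and desc: "facet_describable (convex hull \<Omega>) M"
    and C: "C facet_of (convex hull \<Omega>)"
  obtains a b where "a \<in> integer_vectors" "infnorm a \<le> real M" "b \<in> \<int>"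
    "convex hull \<Omega> \<subseteq> {x. a \<bullet> x \<le> b}" "C = convex hull \<Omega> \<inter> {x. a \<bullet> x = b}"
proof -
  let ?P = "convex hull \<Omega>"
  have "\<Omega> \<noteq> {}" using C by (metis convex_hull_empty facet_of_empty)
  obtain H where H': "\<forall>(a, b) \<in> H. a \<in> integer_vectors \<and> infnorm a \<le> real M"
      and PH: "?P = affine hull ?P \<inter> (\<Inter>(a, b) \<in> H. {p. p \<bullet> a \<le> b})"
    using desc unfolding facet_describable_def by (elim exE conjE) (rule that)
  from H' have H: "a \<in> integer_vectors \<and> infnorm a \<le> real M" if "(a, b) \<in> H" for a b
    using that by auto
  define B where "B a = Max ((\<bullet>) a ` \<Omega>)" for a
  \<comment> \<open>Zero normals are dropped because the facet lemma requires nonzero ones; for them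
    the inequality with \<open>B a = 0\<close> is trivial.\<close>
  define A where "A = fst ` H - {0}"
  define \<H> where "\<H> = (\<lambda>a. {x. a \<bullet> x \<le> B a}) ` A"
  have leB: "a \<bullet> x \<le> B a" if "x \<in> ?P" for a x
  proof -
    have "\<Omega> \<subseteq> {x. a \<bullet> x \<le> B a}"
      unfolding B_def using fin by auto
    then have "?P \<subseteq> {x. a \<bullet> x \<le> B a}"
      by (rule hull_minimal) (rule convex_halfspace_le)
    with that show ?thesis by auto
  qed
  have B_mem: "B a \<in> (\<bullet>) a ` \<Omega>" for a
    unfolding B_def using fin \<open>\<Omega> \<noteq> {}\<close> by (intro Max_in) auto
  have "A \<subseteq> {a. a \<in> integer_vectors \<and> infnorm a \<le> real M}"
    using H by (auto simp: A_def)
  then have "finite \<H>"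
    unfolding \<H>_def using finite_bounded_integer_vectors finite_subset by blast
  have seq: "?P = affine hull ?P \<inter> \<Inter>\<H>"
  proof
    show "?P \<subseteq> affine hull ?P \<inter> \<Inter>\<H>"
      using leB hull_subset[of ?P affine] by (auto simp: \<H>_def)
    have "x \<bullet> a \<le> b" if x: "x \<in> \<Inter>\<H>" and ab: "(a, b) \<in> H" for x a b
    proof -
      have P_le: "y \<bullet> a \<le> b" if "y \<in> ?P" for y
        using that ab PH by blast
      obtain y where y: "y \<in> \<Omega>" "B a = a \<bullet> y" using B_mem by blast
      \<comment> \<open>The maximiser \<open>y\<close> obeys the original constraint, so the new
        half-space is contained in the old one.\<close>
      have "B a \<le> b"
        using P_le[of y] y by (simp add: inner_commute hull_inc)
      moreover have "a \<bullet> x \<le> B a"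
      proof (cases "a = 0")
        case False
        then have "a \<in> A" using ab by (force simp: A_def)
        then show ?thesis using x by (auto simp: \<H>_def)
      qed (use y in auto)
      ultimately show ?thesis by (simp add: inner_commute)
    qed
    then show "affine hull ?P \<inter> \<Inter>\<H> \<subseteq> ?P"
      by (subst (2) PH) auto
  qed
  have "\<forall>h\<in>\<H>. \<exists>a\<in>A. h = {x. a \<bullet> x \<le> B a}"
    by (auto simp: \<H>_def)
  \<comment> \<open>Different normals, such as multiples of one another, may give the same
    half-space; \<open>n\<close> selects one for each.\<close>
  then obtain n where n: "\<forall>h\<in>\<H>. n h \<in> A \<and> h = {x. n h \<bullet> x \<le> B (n h)}"
    by (auto simp: Bex_def dest: bchoice)
  have eq: "n h \<noteq> 0 \<and> h = {x. n h \<bullet> x \<le> B (n h)}" if "h \<in> \<H>" for h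
    using bspec[OF n that] unfolding A_def by blast
  obtain h where h: "h \<in> \<H>" "C = ?P \<inter> {x. n h \<bullet> x = B (n h)}"
    by (rule facet_normal_of_description[OF \<open>finite \<H>\<close> seq eq C])
  have nh: "n h \<in> integer_vectors" "infnorm (n h) \<le> real M"
    using bspec[OF n h(1)] H by (auto simp: A_def)
  moreover have "B (n h) \<in> \<int>"
    using B_mem[of "n h"] nh(1) int by (auto dest: subsetD intro!: inner_integer_vectors)
  ultimately show ?thesis
    using that[of "n h" "B (n h)"] leB h(2) by blast
qed

text \<open>The product form presupposes neither \<open>M > 0\<close> nor a positive distance; both
  follow from it.\<close>

lemma infdist_facet_lower_bound:
  fixes \<Omega> :: "(real ^ 'n) set"
  assumes fin: "finite \<Omega>" and int: "\<Omega> \<subseteq> integer_vectors"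
    and desc: "facet_describable (convex hull \<Omega>) M"
    and F: "F facet_of (convex hull \<Omega>)" and w: "w \<in> \<Omega> - F"
  shows "1 \<le> sqrt (real CARD('n)) * real M * infdist w (affine hull F)"
proof -
  let ?P = "convex hull \<Omega>"
  obtain a b where a: "a \<in> integer_vectors" "infnorm a \<le> real M" and b: "b \<in> \<int>"
      and le: "?P \<subseteq> {x. a \<bullet> x \<le> b}" and eq: "F = ?P \<inter> {x. a \<bullet> x = b}"
    using integral_facet_inequality[OF fin int desc F] .
  have "w \<in> ?P" using w by (auto intro: hull_inc)
  then have "a \<bullet> w < b" using le eq w by (auto simp: order_le_less)
  moreover have "a \<bullet> w \<in> \<int>" using a int w by (auto intro: inner_integer_vectors)
  ultimately have gap: "a \<bullet> w + 1 \<le> b"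
    using b by (elim Ints_cases) auto
  have "norm a \<le> sqrt (real CARD('n)) * infnorm a"
    using norm_le_infnorm[of a] by simp
  also have "\<dots> \<le> sqrt (real CARD('n)) * real M"
    using a by (intro mult_left_mono) auto
  finally have norm_a: "norm a \<le> sqrt (real CARD('n)) * real M" .
  \<comment> \<open>A nearest point exists because the affine hull is closed and nonempty.\<close>
  have "F \<noteq> {}" using F by (simp add: facet_of_def)
  then obtain y where y: "y \<in> affine hull F" "infdist w (affine hull F) = dist w y"
    using infdist_attains_inf[of "affine hull F" w] closed_affine_hull by auto
  have "affine hull F \<subseteq> {x. a \<bullet> x = b}"
    by (intro hull_minimal affine_hyperplane) (auto simp: eq)
  then have "1 \<le> a \<bullet> (y - w)" using gap y by (auto simp: inner_diff_right)
  also have "\<dots> \<le> norm a * dist w y"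
    using norm_cauchy_schwarz[of a "y - w"] by (simp add: dist_norm norm_minus_commute)
  also have "\<dots> \<le> sqrt (real CARD('n)) * real M * dist w y"
    using norm_a by (intro mult_right_mono) auto
  finally show ?thesis using y by simp
qed

text \<open>Two points force positive dimension, hence a facet and a point off it; a polytope has
  finitely many facets. So the \<open>Min\<close> ranges over a finite nonempty set.\<close>

lemma facet_gap_attained:
  fixes \<Omega> :: "(real ^ 'n) set"
  assumes fin: "finite \<Omega>" and "2 \<le> card \<Omega>"
  obtains w F where "F facet_of (convex hull \<Omega>)" "w \<in> \<Omega> - F"
    "facet_gap \<Omega> = infdist w (affine hull F)"
proof -
  let ?P = "convex hull \<Omega>"
  let ?D = "{infdist w (affine hull F) | w F. F facet_of ?P \<and> w \<in> \<Omega> - F}"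
  have poly: "polytope ?P" using fin polytope_convex_hull by blast
  have "\<not> aff_dim \<Omega> \<le> 0"
  proof
    assume "aff_dim \<Omega> \<le> 0"
    then have "aff_dim \<Omega> = -1 \<or> aff_dim \<Omega> = 0"
      using aff_dim_geq[of \<Omega>] by linarith
    then have "\<Omega> = {} \<or> (\<exists>a. \<Omega> = {a})"
      by (metis aff_dim_empty aff_dim_eq_0)
    with assms show False by auto
  qed
  then obtain F where F: "F facet_of ?P"
    using polytope_facet_exists[OF poly] by (auto simp: aff_dim_convex_hull)
  then obtain w where "w \<in> \<Omega> - F" by (rule facet_of_convex_hull_exterior_vertex)
  with F have "?D \<noteq> {}" by blast
  moreover have "finite ?D"
  proof (rule finite_subset)
    show "?D \<subseteq> (\<lambda>(w, F). infdist w (affine hull F)) ` (\<Omega> \<times> {F. F facet_of ?P})" by auto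
    show "finite ((\<lambda>(w, F). infdist w (affine hull F)) ` (\<Omega> \<times> {F. F facet_of ?P}))"
      using fin finite_polytope_facets[OF poly] by blast
  qed
  ultimately have "facet_gap \<Omega> \<in> ?D"
    unfolding facet_gap_def by (intro Min_in)
  then show ?thesis using that by blast
qed

theorem proposition2p7:
  fixes \<Omega> :: "(real ^ 'n) set"
  assumes "finite \<Omega>"
    and "2 \<le> card \<Omega>"
    and "\<Omega> \<subseteq> integer_vectors"
  shows "1 / facet_gap \<Omega> \<le> sqrt (real CARD('n)) * real (ufc (convex hull \<Omega>))"
proof -
  obtain w F where wF: "F facet_of (convex hull \<Omega>)" "w \<in> \<Omega> - F"
      and gap: "facet_gap \<Omega> = infdist w (affine hull F)"
    using facet_gap_attained[OF assms(1,2)] .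
  have "facet_describable (convex hull \<Omega>) (ufc (convex hull \<Omega>))"
    unfolding ufc_def
    using facet_describable_integral_polytope[OF assms(1,3)] by (rule LeastI_ex)
  then have *: "1 \<le> sqrt (real CARD('n)) * real (ufc (convex hull \<Omega>)) * facet_gap \<Omega>"
    unfolding gap using infdist_facet_lower_bound[OF assms(1,3) _ wF] by blast
  \<comment> \<open>A zero gap would turn \<open>*\<close> into \<open>1 \<le> 0\<close>; positivity
    then permits division by the gap.\<close>
  then have "facet_gap \<Omega> \<noteq> 0" by auto
  then have "facet_gap \<Omega> > 0"
    using infdist_nonneg[of w "affine hull F"] gap by linarith
  with * show ?thesis by (simp add: divide_le_eq)
qed

end
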